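(* Let $d,n\ge 1$ be integers, and suppose $G$ and $G'$ are subgroups of $\mathrm{U}(d)$ that are one another's centralizers in $\mathrm{U}(d)$. Then the following two algebras are commutants of one another in $\mathrm{End}((\mathbb{C}^d)^{\otimes n})$: 1. $\mathrm{Alg}\{\mathbf{Q}(G)\}$, the complex algebra spanned by $\mathbf{Q}(G)=\{V^{\otimes n}: V\in G\}$; 2. $\mathrm{Alg}\{(G')^{\times n},\mathbf{P}(\mathcal{S}_n)\}$, the complex algebra spanned by the group $\langle (G')^{\times n},\mathbf{P}(\mathcal{S}_n)\rangle$ generated by $(G')^{\times n}=\{U_1\otimes\cdots\otimes U_n: U_i\in G'\}$ and $\mathbf{P}(\mathcal{S}_n)$.
   Context: $\mathrm{U}(d)$ is the unitary group of $\mathbb{C}^d$. The centralizer of a subgroup $H$ of $\mathrm{U}(d)$ is the set of elements of $\mathrm{U}(d)$ commuting with every element of $H$. $\mathbf{P}$ is the representation of the symmetric group $\mathcal{S}_n$ on $(\mathbb{C}^d)^{\otimes n}$ permuting tensor factors: $\mathbf{P}(s)|i_1\rangle\otimes\cdots\otimes|i_n\rangle=|i_{s^{-1}(1)}\rangle\otimes\cdots\otimes|i_{s^{-1}(n)}\rangle$, and $\mathbf{P}(\mathcal{S}_n)=\{\mathbf{P}(s):s\in\mathcal{S}_n\}$. The commutant of a subset of $\mathrm{End}(\mathcal{V})$ is the set of all operators in $\mathrm{End}(\mathcal{V})$ commuting with every element of the subset. *)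

theory Defs
  imports "HOL-Analysis.Analysis" "HOL-Algebra.Generated_Groups"
begin

text \<open>
  The type \<open>'d\<close> indexes the computational basis of $\mathbb{C}^d$ and \<open>'n\<close> labels the tensor
  factors, so $d$ and $n$ are \<open>CARD('d)\<close> and \<open>CARD('n)\<close>. The basis vector
  $|i_1\rangle\otimes\cdots\otimes|i_n\rangle$ of $(\mathbb{C}^d)^{\otimes n}$ is indexed by the
  function \<open>i :: 'n \<Rightarrow> 'd\<close>; operators are matrices in this basis.
\<close>

type_synonym 'a op = "complex ^ 'a ^ 'a"

type_synonym ('d, 'n) tensor_vec = "complex ^ ('n \<Rightarrow> 'd)"

type_synonym ('d, 'n) tensor_op = "('n \<Rightarrow> 'd) op"

definition adjoint_op :: "'a op \<Rightarrow> 'a::finite op" where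
  "adjoint_op A = (\<chi> i j. cnj (A $ j $ i))"

definition unitary_group :: "('a::finite op) monoid" where
  "unitary_group =
     \<lparr>carrier = {U. adjoint_op U ** U = mat 1 \<and> U ** adjoint_op U = mat 1},
      mult = (**), one = mat 1\<rparr>"

definition centralizer :: "'a::finite op set \<Rightarrow> 'a op set" where
  "centralizer H = {U \<in> carrier unitary_group. \<forall>V\<in>H. U ** V = V ** U}"

definition commutant :: "'a::finite op set \<Rightarrow> 'a op set" where
  "commutant S = {A. \<forall>B\<in>S. A ** B = B ** A}"

definition scale_op :: "complex \<Rightarrow> 'a op \<Rightarrow> 'a::finite op" where
  "scale_op c A = (\<chi> i j. c * A $ i $ j)"

text \<open>The span of a group of operators is already closed under products. The library's
  unqualified \<open>span\<close> is the real span, hence the explicit complex scaling.\<close>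

definition complex_span :: "'a::finite op set \<Rightarrow> 'a op set" where
  "complex_span = module.span scale_op"

definition tensor :: "('n \<Rightarrow> 'd op) \<Rightarrow> ('d::finite, 'n::finite) tensor_op" where
  "tensor U = (\<chi> i j. \<Prod>k\<in>UNIV. U k $ i k $ j k)"

definition tensor_vec :: "('n \<Rightarrow> complex ^ 'd) \<Rightarrow> ('d::finite, 'n::finite) tensor_vec" where
  "tensor_vec x = (\<chi> i. \<Prod>k\<in>UNIV. x k $ i k)"

definition tensor_powers :: "'d op set \<Rightarrow> ('d::finite, 'n::finite) tensor_op set" where
  "tensor_powers G = {tensor (\<lambda>_. V) | V. V \<in> G}"

definition local_ops :: "'d op set \<Rightarrow> ('d::finite, 'n::finite) tensor_op set" where
  "local_ops G = {tensor U | U. \<forall>k. U k \<in> G}"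

text \<open>The unqualified \<open>inv\<close> would also parse as a group inverse.\<close>

definition perm_op :: "('n \<Rightarrow> 'n) \<Rightarrow> ('d::finite, 'n::finite) tensor_op" where
  "perm_op s = (\<chi> i j. if i = j \<circ> Hilbert_Choice.inv s then 1 else 0)"

definition perm_ops :: "('d::finite, 'n::finite) tensor_op set" where
  "perm_ops = {perm_op s | s. s permutes UNIV}"

lemma group_unitary_group: "group (unitary_group :: ('a::finite op) monoid)"
proof -
  have adj_mult: "adjoint_op (A ** B) = adjoint_op B ** adjoint_op A" for A B :: "'a op"
    by (simp add: adjoint_op_def matrix_matrix_mult_def vec_eq_iff mult.commute)
  have adj_one: "adjoint_op (mat 1 :: 'a op) = mat 1"
    by (simp add: adjoint_op_def mat_def vec_eq_iff)
  have adj_adj: "adjoint_op (adjoint_op A) = A" for A :: "'a op"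
    by (simp add: adjoint_op_def vec_eq_iff)
  have cancel: "B ** (A ** (C ** D)) = B ** D" if "A ** C = mat 1" for A B C D :: "'a op"
    using that by (simp add: matrix_mul_assoc)
  show ?thesis
    by (rule groupI)
      (auto simp: unitary_group_def adj_mult adj_one adj_adj cancel matrix_mul_assoc[symmetric]
        intro: exI[of _ "adjoint_op _"])
qed

lemma vector_space_scale_op: "vector_space (scale_op :: complex \<Rightarrow> 'a::finite op \<Rightarrow> 'a op)"
  by unfold_locales (simp_all add: scale_op_def vec_eq_iff algebra_simps)

lemma tensor_apply: "tensor U *v tensor_vec x = tensor_vec (\<lambda>k. U k *v x k)"
  by (simp add: tensor_def tensor_vec_def matrix_vector_mult_def vec_eq_iff
      prod.distrib[symmetric] prod_sum_PiE PiE_UNIV_domain)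

lemma tensor_mult: "tensor U ** tensor V = tensor (\<lambda>k. U k ** V k)"
  by (simp add: tensor_def matrix_matrix_mult_def vec_eq_iff
      prod.distrib[symmetric] prod_sum_PiE PiE_UNIV_domain)

lemma tensor_unitary:
  assumes "\<And>k. U k \<in> carrier unitary_group"
  shows "tensor U \<in> carrier unitary_group"
proof -
  have "adjoint_op (tensor U) = tensor (\<lambda>k. adjoint_op (U k))"
    by (simp add: adjoint_op_def tensor_def vec_eq_iff)
  moreover have "tensor (\<lambda>_. mat 1) = (mat 1 :: ('b, 'a) tensor_op)"
    by (auto simp: tensor_def mat_def vec_eq_iff fun_eq_iff intro: prod_zero)
  ultimately show ?thesis
    using assms by (simp add: unitary_group_def tensor_mult)
qed

lemma perm_op_apply:
  "perm_op s *v axis i 1 = (axis (i \<circ> Hilbert_Choice.inv s) 1 :: ('d::finite, 'n::finite) tensor_vec)"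
  by (simp add: perm_op_def matrix_vector_mult_def axis_def vec_eq_iff if_distrib[of "(*) _"]
      cong: if_cong)

lemma perm_op_unitary:
  assumes "s permutes UNIV"
  shows "(perm_op s :: ('d::finite, 'n::finite) tensor_op) \<in> carrier unitary_group"
proof -
  have s: "bij s" "s \<circ> Hilbert_Choice.inv s = id" "Hilbert_Choice.inv s \<circ> s = id"
    using assms by (simp_all add: permutes_bij permutes_inv_o)
  have eq: "i = j \<circ> Hilbert_Choice.inv s \<longleftrightarrow> j = i \<circ> s" for i j :: "'n \<Rightarrow> 'd"
    using s by (metis comp_assoc comp_id)
  have eq': "i \<circ> s = j \<circ> s \<longleftrightarrow> i = j" for i j :: "'n \<Rightarrow> 'd"
    using s by (metis comp_assoc comp_id)
  have c: "(\<Sum>k\<in>UNIV. (if k = a then 1 else 0) * (if k = b then 1 else 0)) =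
      (if a = b then 1 else 0 :: complex)" for a b :: "'n \<Rightarrow> 'd"
    by (simp add: if_distrib[of "\<lambda>x. x * _"] cong: if_cong)
  have inj: "i \<circ> Hilbert_Choice.inv s = j \<circ> Hilbert_Choice.inv s \<longleftrightarrow> i = j" for i j :: "'n \<Rightarrow> 'd"
    using s by (metis comp_assoc comp_id)
  have "adjoint_op (perm_op s :: ('d, 'n) tensor_op) ** perm_op s = mat 1"
    by (simp add: adjoint_op_def perm_op_def matrix_matrix_mult_def vec_eq_iff mat_def
        if_distrib[of cnj] c inj cong: if_cong)
  moreover have "(perm_op s :: ('d, 'n) tensor_op) ** adjoint_op (perm_op s) = mat 1"
    unfolding perm_op_def eq
    by (simp add: adjoint_op_def matrix_matrix_mult_def vec_eq_iff mat_def
        if_distrib[of cnj] c eq' cong: if_cong)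
  ultimately show ?thesis by (simp add: unitary_group_def)
qed

end

(*
  By the bicommutant theorem for the group generated by local_ops G' and perm_ops, it suffices to
  compute the commutant of that group. Let C be the commutant of G'. Commuting with local_ops G'
  puts an operator into the span of the tensors U_1 (x) ... (x) U_n with all U_k in C: apply a
  linear projection onto C one site at a time, which fixes the operator. Commuting with perm_ops
  makes it equal to its own average over permutations, hence by polarization a combination of tensor
  powers of elements of C. Finally the unitary group G of C is Zariski dense in C: a subspace that
  contains all V (x) ... (x) V with V in G contains, by a polynomial identity along Cayley
  transforms, the tensor powers of the hermitian elements of C, and then, since A = H + iK, those of
  all elements.
*)

theory Submission
  imports Defs
begin

section \<open>Operators and the bicommutant theorem\<close>

interpretation op: vector_space "scale_op :: complex \<Rightarrow> 'a::finite op \<Rightarrow> 'a op"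
  by (rule vector_space_scale_op)

lemma complex_span_eq: "complex_span = op.span"
  by (simp add: complex_span_def)

lemma scale_op_nth [simp]: "scale_op c A $ i $ j = c * A $ i $ j"
  by (simp add: scale_op_def)

lemma scale_op_mult_left: "scale_op c A ** B = scale_op c (A ** B)"
  by (simp add: vec_eq_iff matrix_matrix_mult_def sum_distrib_left mult.assoc)

lemma scale_op_mult_right: "A ** scale_op c B = scale_op c (A ** B)"
  by (simp add: vec_eq_iff matrix_matrix_mult_def sum_distrib_left mult.left_commute)

lemma adjoint_op_nth [simp]: "adjoint_op A $ i $ j = cnj (A $ j $ i)"
  by (simp add: adjoint_op_def)

lemma adjoint_op_mult: "adjoint_op (A ** B) = adjoint_op B ** adjoint_op A"
  by (simp add: matrix_matrix_mult_def vec_eq_iff mult.commute)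

lemma adjoint_op_adjoint_op [simp]: "adjoint_op (adjoint_op A) = A"
  by (simp add: vec_eq_iff)

lemma adjoint_op_mat_1 [simp]: "adjoint_op (mat 1) = mat 1"
  by (simp add: mat_def vec_eq_iff)

lemma matrix_mult_add_rdistrib: "(A + B) ** C = A ** C + B ** (C :: 'a::finite op)"
  by (simp add: matrix_matrix_mult_def vec_eq_iff sum.distrib distrib_right)

lemma matrix_mult_add_ldistrib: "A ** (B + C) = A ** B + A ** (C :: 'a::finite op)"
  by (simp add: matrix_matrix_mult_def vec_eq_iff sum.distrib distrib_left)

lemma matrix_mult_diff_rdistrib: "(A - B) ** C = A ** C - B ** (C :: 'a::finite op)"
  by (simp add: matrix_matrix_mult_def vec_eq_iff sum_subtractf left_diff_distrib)

lemma matrix_mult_diff_ldistrib: "A ** (B - C) = A ** B - A ** (C :: 'a::finite op)"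
  by (simp add: matrix_matrix_mult_def vec_eq_iff sum_subtractf right_diff_distrib)

lemmas matrix_mult_distribs = matrix_mult_add_rdistrib matrix_mult_add_ldistrib
  matrix_mult_diff_rdistrib matrix_mult_diff_ldistrib

section \<open>The real Hilbert-Schmidt inner product and orthogonal projections\<close>

lemma inner_op: "inner X Y = Re (\<Sum>i\<in>UNIV. \<Sum>j\<in>UNIV. X $ i $ j * cnj (Y $ i $ j))"
  for X Y :: "'a::finite op"
  by (simp add: inner_vec_def inner_complex_def)

lemma inner_scale_op: "inner (scale_op c X) Y = inner X (scale_op (cnj c) Y)"
  by (simp add: inner_op mult_ac)

text \<open>Used to show that invariance of a space under a self-adjoint set of left factors passes
  to its orthogonal complement.\<close>

lemma inner_mult_op: "inner (A ** X) Y = inner X (adjoint_op A ** Y)"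
  for A X Y :: "'a::finite op"
proof -
  have "(\<Sum>i\<in>UNIV. \<Sum>j\<in>UNIV. (A ** X) $ i $ j * cnj (Y $ i $ j)) =
      (\<Sum>i\<in>UNIV. \<Sum>j\<in>UNIV. \<Sum>k\<in>UNIV. A $ i $ k * X $ k $ j * cnj (Y $ i $ j))"
    by (simp add: matrix_matrix_mult_def sum_distrib_right)
  also have "\<dots> = (\<Sum>i\<in>UNIV. \<Sum>k\<in>UNIV. \<Sum>j\<in>UNIV. A $ i $ k * X $ k $ j * cnj (Y $ i $ j))"
    by (rule sum.cong [OF refl], rule sum.swap)
  also have "\<dots> = (\<Sum>k\<in>UNIV. \<Sum>i\<in>UNIV. \<Sum>j\<in>UNIV. A $ i $ k * X $ k $ j * cnj (Y $ i $ j))"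
    by (rule sum.swap)
  also have "\<dots> = (\<Sum>k\<in>UNIV. \<Sum>j\<in>UNIV. \<Sum>i\<in>UNIV. A $ i $ k * X $ k $ j * cnj (Y $ i $ j))"
    by (rule sum.cong [OF refl], rule sum.swap)
  also have "\<dots> = (\<Sum>k\<in>UNIV. \<Sum>j\<in>UNIV. X $ k $ j * cnj ((adjoint_op A ** Y) $ k $ j))"
    by (simp add: matrix_matrix_mult_def sum_distrib_left mult_ac)
  finally show ?thesis by (simp only: inner_op)
qed

lemma op_subspace_imp_subspace: "op.subspace W \<Longrightarrow> subspace W"
proof -
  have "r *\<^sub>R X = scale_op (of_real r) X" for r and X :: "'a op"
    by (simp add: vec_eq_iff scaleR_conv_of_real [where 'a = complex])
  then show "op.subspace W \<Longrightarrow> subspace W" for W :: "'a op set"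
    by (simp add: op.subspace_def subspace_def)
qed

text \<open>Orthogonality refers only to the real part of the Hilbert-Schmidt product. For a complex
  subspace \<open>W\<close> this is complex orthogonality, because \<open>Z\<close> may be replaced
  by its multiple by i.\<close>

definition orth_proj :: "'a::finite op set \<Rightarrow> 'a op \<Rightarrow> 'a op" where
  "orth_proj W X = (SOME Y. Y \<in> W \<and> (\<forall>Z\<in>W. inner (X - Y) Z = 0))"

context
  fixes W :: "'a::finite op set"
  assumes W: "op.subspace W"
begin

lemma orth_proj: "orth_proj W X \<in> W \<and> (\<forall>Z\<in>W. inner (X - orth_proj W X) Z = 0)"
proof -
  have span: "span W = W"
    using W by (simp add: op_subspace_imp_subspace)
  obtain Y Z where "Y \<in> span W" "\<And>w. w \<in> span W \<Longrightarrow> orthogonal Z w" "X = Y + Z"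
    using orthogonal_subspace_decomp_exists [of W X] by metis
  then have "Y \<in> W \<and> (\<forall>w\<in>W. inner (X - Y) w = 0)"
    by (simp add: span orthogonal_def)
  then show ?thesis
    unfolding orth_proj_def by (rule someI)
qed

lemma orth_proj_in: "orth_proj W X \<in> W"
  and orth_proj_orth: "Z \<in> W \<Longrightarrow> inner (X - orth_proj W X) Z = 0"
  using orth_proj by auto

lemma orth_proj_eqI:
  assumes "Y \<in> W" and "\<And>Z. Z \<in> W \<Longrightarrow> inner (X - Y) Z = 0"
  shows "orth_proj W X = Y"
proof -
  let ?D = "orth_proj W X - Y"
  have D: "?D \<in> W"
    using W assms(1) by (simp add: op.subspace_diff orth_proj_in)
  have "inner ?D ?D = inner (X - Y) ?D - inner (X - orth_proj W X) ?D"
    by (simp add: inner_diff_left)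
  also have "\<dots> = 0"
    using D by (simp add: assms(2) orth_proj_orth)
  finally show ?thesis by simp
qed

lemma orth_proj_ident: "X \<in> W \<Longrightarrow> orth_proj W X = X"
  by (rule orth_proj_eqI) auto

lemma linear_orth_proj: "Vector_Spaces.linear scale_op scale_op (orth_proj W)"
proof -
  have add: "orth_proj W (X + Y) = orth_proj W X + orth_proj W Y" for X Y
  proof (rule orth_proj_eqI)
    show "orth_proj W X + orth_proj W Y \<in> W"
      using W by (simp add: op.subspace_add orth_proj_in)
    show "inner (X + Y - (orth_proj W X + orth_proj W Y)) Z = 0" if "Z \<in> W" for Z
      using orth_proj_orth [OF that, of X] orth_proj_orth [OF that, of Y]
      by (simp add: inner_diff_left inner_add_left)
  qed
  have scale: "orth_proj W (scale_op c X) = scale_op c (orth_proj W X)" for c X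
  proof (rule orth_proj_eqI)
    show "scale_op c (orth_proj W X) \<in> W"
      using W by (simp add: op.subspace_scale orth_proj_in)
    \<comment> \<open>The scalar moves to the other side as \<open>cnj c\<close>, and
      \<open>W\<close> is closed under complex scaling; this makes a real orthogonal projection
      complex linear.\<close>
    show "inner (scale_op c X - scale_op c (orth_proj W X)) Z = 0" if "Z \<in> W" for Z
      using W that
      by (simp add: op.scale_right_diff_distrib [symmetric] inner_scale_op orth_proj_orth op.subspace_scale)
  qed
  show ?thesis
    by unfold_locales (simp_all add: add scale)
qed

end

section \<open>Matrix units and linear maps on operators\<close>

definition unit_op :: "'a \<Rightarrow> 'a \<Rightarrow> 'a::finite op" where
  "unit_op k l = (\<chi> i j. if i = k \<and> j = l then 1 else 0)"

lemma op_decomp: "X = (\<Sum>k\<in>UNIV. \<Sum>l\<in>UNIV. scale_op (X $ k $ l) (unit_op k l))"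
  for X :: "'a::finite op"
proof -
  have "(\<Sum>k\<in>UNIV. \<Sum>l\<in>UNIV. X $ k $ l * (if i = k \<and> j = l then 1 else 0)) = X $ i $ j" for i j
  proof -
    have "(\<Sum>l\<in>UNIV. X $ k $ l * (if i = k \<and> j = l then 1 else 0)) =
        (if i = k then X $ k $ j else 0)" for k
      by (simp add: if_distrib cong: if_cong)
    then show ?thesis by simp
  qed
  then show ?thesis
    by (simp add: vec_eq_iff unit_op_def)
qed

text \<open>Exhibits the entries of \<open>f X\<close> as fixed linear combinations of the entries
  of \<open>X\<close>, so that polynomial dependence on a parameter survives a projection.\<close>

lemma linear_op_decomp:
  assumes "Vector_Spaces.linear scale_op scale_op f"
  shows "f X = (\<Sum>k\<in>UNIV. \<Sum>l\<in>UNIV. scale_op (X $ k $ l) (f (unit_op k l)))"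
proof -
  interpret f: Vector_Spaces.linear scale_op scale_op f by fact
  show ?thesis
    by (subst op_decomp [of X]) (simp add: f.sum f.scale)
qed

lemma mult_unit_op: "T ** unit_op k l = (\<Sum>m\<in>UNIV. scale_op (T $ m $ k) (unit_op m l))"
proof -
  have "(T ** unit_op k l) $ i $ j = (if j = l then T $ i $ k else 0)" for i j
    by (simp add: matrix_matrix_mult_def unit_op_def if_distrib cong: if_cong)
  moreover have "(\<Sum>m\<in>UNIV. scale_op (T $ m $ k) (unit_op m l)) $ i $ j = (if j = l then T $ i $ k else 0)" for i j
    by (simp add: unit_op_def if_distrib cong: if_cong)
  ultimately show ?thesis by (simp add: vec_eq_iff)
qed

text \<open>A linear map on operators that intertwines left multiplication by \<open>T\<close> is a matrix of blocks
  commuting with \<open>T\<close>. This replaces the amplification step of the bicommutant theorem.\<close>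

lemma block_commute_iff:
  assumes "Vector_Spaces.linear scale_op scale_op f"
  shows "(\<forall>k l. f (T ** unit_op k l) = T ** f (unit_op k l)) \<longleftrightarrow>
    (\<forall>j l. (\<chi> i k. f (unit_op k l) $ i $ j) ** T = T ** (\<chi> i k. f (unit_op k l) $ i $ j))"
proof -
  interpret f: Vector_Spaces.linear scale_op scale_op f by fact
  have "f (T ** unit_op k l) $ i $ j = ((\<chi> i k. f (unit_op k l) $ i $ j) ** T) $ i $ k" for i j k l
    unfolding mult_unit_op by (simp add: f.sum f.scale matrix_matrix_mult_def mult.commute)
  moreover have "(T ** f (unit_op k l)) $ i $ j = (T ** (\<chi> i k. f (unit_op k l) $ i $ j)) $ i $ k" for i j k l
    by (simp add: matrix_matrix_mult_def)
  ultimately show ?thesis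
    unfolding vec_eq_iff by auto
qed

section \<open>Commutants and the bicommutant theorem\<close>

lemma subspace_commutant: "op.subspace (commutant S)"
  unfolding op.subspace_def commutant_def
  by (simp add: matrix_mult_distribs scale_op_mult_left scale_op_mult_right)

lemma commutant_antimono: "S \<subseteq> T \<Longrightarrow> commutant T \<subseteq> commutant S"
  by (auto simp: commutant_def)

lemma subset_commutant_commutant: "S \<subseteq> commutant (commutant S)"
  by (auto simp: commutant_def)

lemma commutant_complex_span: "commutant (complex_span S) = commutant S"
proof
  show "commutant (complex_span S) \<subseteq> commutant S"
    unfolding complex_span_eq by (intro commutant_antimono op.span_superset)
  have "complex_span S \<subseteq> commutant (commutant S)"
    unfolding complex_span_eq
    by (intro op.span_minimal subset_commutant_commutant subspace_commutant)
  then show "commutant S \<subseteq> commutant (complex_span S)"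
    by (auto simp: commutant_def)
qed

text \<open>The projection onto the span of \<open>H\<close> commutes with left multiplication by
  \<open>H\<close>. Hence its blocks lie in the commutant of \<open>H\<close> and commute with every
  \<open>T\<close> in the bicommutant, so the projection also commutes with left multiplication by
  \<open>T\<close>. It fixes \<open>mat 1\<close>, hence it fixes \<open>T\<close>.\<close>

theorem double_commutant:
  fixes H :: "'a::finite op set"
  assumes one: "mat 1 \<in> H"
    and mult: "\<And>A B. A \<in> H \<Longrightarrow> B \<in> H \<Longrightarrow> A ** B \<in> H"
    and adj: "\<And>A. A \<in> H \<Longrightarrow> adjoint_op A \<in> H"
  shows "commutant (commutant H) = complex_span H"
proof
  let ?W = "op.span H" let ?P = "orth_proj ?W"
  have W: "op.subspace ?W" by simp
  interpret P: Vector_Spaces.linear scale_op scale_op ?P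
    by (rule linear_orth_proj [OF W])
  have mult_W: "A ** X \<in> ?W" if A: "A \<in> H" and X: "X \<in> ?W" for A X
    using X
  proof (induction rule: op.span_induct_alt)
    case base
    then show ?case
      by (simp add: matrix_matrix_mult_def op.span_zero flip: zero_vec_def)
  next
    case (step c x y)
    then show ?case
      using A mult by (simp add: matrix_mult_distribs scale_op_mult_right op.span_add op.span_scale op.span_base)
  qed
  \<comment> \<open>\<open>A\<close> preserves the span, and since \<open>adjoint_op A\<close> does
    too, \<open>A\<close> also preserves the orthogonal complement.\<close>
  have P_mult: "?P (A ** X) = A ** ?P X" if A: "A \<in> H" for A X
  proof (rule orth_proj_eqI [OF W])
    show "A ** ?P X \<in> ?W"
      using A by (simp add: mult_W orth_proj_in)
    show "inner (A ** X - A ** ?P X) Z = 0" if "Z \<in> ?W" for Z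
      using A that
      by (simp add: matrix_mult_diff_ldistrib [symmetric] inner_mult_op orth_proj_orth mult_W adj)
  qed
  show "commutant (commutant H) \<subseteq> complex_span H"
  proof
    fix T assume T: "T \<in> commutant (commutant H)"
    have "(\<chi> i k. ?P (unit_op k l) $ i $ j) \<in> commutant H" for j l
      unfolding commutant_def
      using block_commute_iff [THEN iffD1, OF linear_orth_proj [OF W]] P_mult by blast
    then have PT: "?P (T ** unit_op k l) = T ** ?P (unit_op k l)" for k l
      using T block_commute_iff [OF linear_orth_proj [OF W], of T]
      by (simp add: commutant_def)
    have "?P (T ** X) = T ** ?P X" for X
    proof -
      have sum_right: "T ** (\<Sum>k\<in>UNIV. g k) = (\<Sum>k\<in>UNIV. T ** g k)" for g :: "'a \<Rightarrow> 'a op"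
        by (simp add: vec_eq_iff matrix_matrix_mult_def sum_distrib_left) (intro allI sum.swap)
      show ?thesis
        by (subst (1 2) op_decomp [of X])
          (simp only: sum_right scale_op_mult_right P.sum P.scale PT)
    qed
    from this [of "mat 1"] have "?P T = T"
      using one by (simp add: orth_proj_ident op.span_base)
    then show "T \<in> complex_span H"
      unfolding complex_span_eq using orth_proj_in [OF W, of T] by simp
  qed
  show "complex_span H \<subseteq> commutant (commutant H)"
    unfolding complex_span_eq
    by (intro op.span_minimal subset_commutant_commutant subspace_commutant)
qed

section \<open>The commutant of the local operators\<close>

text \<open>The map acting as \<open>f\<close> on the tensor factor at \<open>k\<close> and as the
  identity on the others. In coordinates, all indices away from \<open>k\<close> are frozen and
  \<open>f\<close> is applied to the remaining matrix.\<close>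

definition site_op :: "'n \<Rightarrow> ('d op \<Rightarrow> 'd op) \<Rightarrow> ('d::finite, 'n::finite) tensor_op \<Rightarrow> ('d, 'n) tensor_op" where
  "site_op k f X = (\<chi> a b. f (\<chi> u v. X $ a(k := u) $ b(k := v)) $ a k $ b k)"

lemma tensor_slice:
  fixes U :: "'n::finite \<Rightarrow> 'd::finite op"
  shows "(\<chi> u v. tensor U $ a(k := u) $ b(k := v)) =
    scale_op (\<Prod>l\<in>UNIV - {k}. U l $ a l $ b l) (U k)"
proof -
  have "(\<Prod>l\<in>UNIV. U l $ (a(k := u)) l $ (b(k := v)) l) =
      U k $ u $ v * (\<Prod>l\<in>UNIV - {k}. U l $ a l $ b l)" for u v
    by (subst prod.remove [of _ k]) (auto intro!: prod.cong)
  then show ?thesis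
    by (simp add: tensor_def vec_eq_iff mult.commute)
qed

lemma site_op_tensor:
  assumes "Vector_Spaces.linear scale_op scale_op f"
  shows "site_op k f (tensor U) = tensor (U(k := f (U k)))"
proof -
  interpret f: Vector_Spaces.linear scale_op scale_op f by fact
  have "(\<Prod>l\<in>UNIV. (U(k := f (U k))) l $ a l $ b l) =
      f (U k) $ a k $ b k * (\<Prod>l\<in>UNIV - {k}. U l $ a l $ b l)" for a b
    by (subst prod.remove [of _ k]) (auto intro!: prod.cong)
  then show ?thesis
    unfolding site_op_def tensor_slice f.scale
    by (simp add: tensor_def vec_eq_iff mult.commute)
qed

lemma linear_site_op:
  fixes f :: "'d::finite op \<Rightarrow> 'd op" and k :: "'n::finite"
  assumes "Vector_Spaces.linear scale_op scale_op f"
  shows "Vector_Spaces.linear scale_op scale_op (site_op k f)"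
proof -
  interpret f: Vector_Spaces.linear scale_op scale_op f by fact
  have add: "(\<chi> u v. X $ a(k := u) $ b(k := v) + Y $ a(k := u) $ b(k := v)) =
      (\<chi> u v. X $ a(k := u) $ b(k := v)) + (\<chi> u v. Y $ a(k := u) $ b(k := v))"
    and scale: "(\<chi> u v. c * X $ a(k := u) $ b(k := v)) =
      scale_op c (\<chi> u v. X $ a(k := u) $ b(k := v))"
    for X Y :: "('d, 'n) tensor_op" and a b c
    by (simp_all add: vec_eq_iff)
  show ?thesis
  proof unfold_locales
    show "site_op k f (X + Y) = site_op k f X + site_op k f Y" for X Y
      unfolding vec_eq_iff by (simp add: site_op_def add f.add)
    show "site_op k f (scale_op c X) = scale_op c (site_op k f X)" for c X
      unfolding vec_eq_iff by (simp add: site_op_def scale f.scale)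
  qed
qed

section \<open>Operators acting on a single site\<close>

definition at_site :: "'n \<Rightarrow> 'd op \<Rightarrow> 'n \<Rightarrow> 'd::finite op" where
  "at_site k B = (\<lambda>_. mat 1)(k := B)"

lemma tensor_at_site_nth:
  fixes B :: "'d::finite op"
  shows "tensor (at_site k B) $ a $ b = (if \<forall>l. l \<noteq> k \<longrightarrow> a l = b l then B $ a k $ b k else 0)"
proof -
  have "(\<Prod>l\<in>UNIV. at_site k B l $ a l $ b l) =
      B $ a k $ b k * (\<Prod>l\<in>UNIV - {k}. mat 1 $ a l $ b l)"
    by (subst prod.remove [of _ k]) (auto intro!: prod.cong simp: at_site_def)
  also have "(\<Prod>l\<in>UNIV - {k}. mat 1 $ a l $ b l :: complex) = (if \<forall>l. l \<noteq> k \<longrightarrow> a l = b l then 1 else 0)"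
    by (auto simp: mat_def intro!: prod.neutral prod_zero)
  finally show ?thesis by (auto simp: tensor_def)
qed

lemma sum_differ_at_site:
  fixes F :: "('n::finite \<Rightarrow> 'd::finite) \<Rightarrow> complex"
  shows "(\<Sum>c\<in>UNIV. if \<forall>l. l \<noteq> k \<longrightarrow> c l = a l then F c else 0) = (\<Sum>u\<in>UNIV. F (a(k := u)))"
proof -
  have "(\<Sum>c\<in>UNIV. if \<forall>l. l \<noteq> k \<longrightarrow> c l = a l then F c else 0) =
      (\<Sum>c\<in>{c. \<forall>l. l \<noteq> k \<longrightarrow> c l = a l}. F c)"
    by (simp add: sum.If_cases)
  also have "{c. \<forall>l. l \<noteq> k \<longrightarrow> c l = a l} = range (\<lambda>u. a(k := u))"
  proof (intro equalityI subsetI)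
    fix c assume "c \<in> {c. \<forall>l. l \<noteq> k \<longrightarrow> c l = a l}"
    then have "c = a(k := c k)" by auto
    then show "c \<in> range (\<lambda>u. a(k := u))" by blast
  qed auto
  also have "sum F \<dots> = (\<Sum>u\<in>UNIV. F (a(k := u)))"
    by (subst sum.reindex) (auto simp: inj_on_def fun_upd_eqD)
  finally show ?thesis .
qed

text \<open>The indices away from \<open>k\<close> are spectators for \<open>at_site k B\<close>, so
  the commutation relation splits into one relation for each way of freezing them.\<close>

lemma slice_commute:
  fixes B :: "'d::finite op" and X :: "('d, 'n::finite) tensor_op"
  assumes "X ** tensor (at_site k B) = tensor (at_site k B) ** X"
  shows "(\<chi> u v. X $ a(k := u) $ b(k := v)) ** B = B ** (\<chi> u v. X $ a(k := u) $ b(k := v))"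
proof -
  have "(X ** tensor (at_site k B)) $ a(k := u) $ b(k := v) =
      ((\<chi> u v. X $ a(k := u) $ b(k := v)) ** B) $ u $ v" for u v
  proof -
    have "(X ** tensor (at_site k B)) $ a(k := u) $ b(k := v) =
      (\<Sum>c\<in>UNIV. if \<forall>l. l \<noteq> k \<longrightarrow> c l = (b(k := v)) l then X $ a(k := u) $ c * B $ c k $ v else 0)"
      by (simp add: matrix_matrix_mult_def tensor_at_site_nth if_distrib cong: if_cong)
    then show ?thesis
      unfolding sum_differ_at_site [of k "b(k := v)"] by (simp add: matrix_matrix_mult_def)
  qed
  moreover have "(tensor (at_site k B) ** X) $ a(k := u) $ b(k := v) =
      (B ** (\<chi> u v. X $ a(k := u) $ b(k := v))) $ u $ v" for u v
  proof -
    have "(tensor (at_site k B) ** X) $ a(k := u) $ b(k := v) =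
      (\<Sum>c\<in>UNIV. if \<forall>l. l \<noteq> k \<longrightarrow> (a(k := u)) l = c l then B $ u $ c k * X $ c $ b(k := v) else 0)"
      by (simp add: matrix_matrix_mult_def tensor_at_site_nth if_distrib [of "\<lambda>x. x * _"] cong: if_cong)
    also have "\<dots> = (\<Sum>c\<in>UNIV. if \<forall>l. l \<noteq> k \<longrightarrow> c l = (a(k := u)) l then B $ u $ c k * X $ c $ b(k := v) else 0)"
      by (simp only: eq_commute [of "(a(k := u)) _"])
    finally show ?thesis
      unfolding sum_differ_at_site [of k "a(k := u)"] by (simp add: matrix_matrix_mult_def)
  qed
  ultimately show ?thesis
    using assms by (simp add: vec_eq_iff)
qed

lemma site_op_orth_proj_commutant:
  assumes "\<And>B. B \<in> S \<Longrightarrow> X ** tensor (at_site k B) = tensor (at_site k B) ** X"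
  shows "site_op k (orth_proj (commutant S)) X = X"
proof -
  have "(\<chi> u v. X $ a(k := u) $ b(k := v)) \<in> commutant S" for a b
    unfolding commutant_def using slice_commute assms by blast
  then show ?thesis
    by (simp add: site_op_def orth_proj_ident subspace_commutant vec_eq_iff)
qed

text \<open>Supplies the fact that elementary tensors span all operators on the tensor
  product.\<close>

lemma tensor_unit_op: "tensor (\<lambda>k. unit_op (a k) (b k)) = unit_op a b"
proof -
  have "(\<Prod>k\<in>UNIV. if i k = a k \<and> j k = b k then 1 else 0 :: complex) =
      (if i = a \<and> j = b then 1 else 0)" for i j
    by (auto simp: fun_eq_iff intro: prod_zero)
  then show ?thesis
    by (simp add: tensor_def unit_op_def)
qed

text \<open>Induction on the set \<open>T\<close> of sites whose factors already lie in the
  commutant. As \<open>mat 1\<close> is in \<open>S\<close>, each \<open>at_site k B\<close> with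
  \<open>B\<close> in \<open>S\<close> is local, so projecting at \<open>k\<close> fixes
  \<open>X\<close>, while it moves the factor at \<open>k\<close> of each spanning tensor into the
  commutant.\<close>

lemma commutant_local_ops_subset:
  fixes S :: "'d::finite op set"
  assumes "mat 1 \<in> S"
  shows "commutant (local_ops S :: ('d, 'n::finite) tensor_op set) \<subseteq> op.span (local_ops (commutant S))"
proof
  fix X :: "('d, 'n) tensor_op"
  assume X: "X \<in> commutant (local_ops S)"
  let ?P = "orth_proj (commutant S)"
  have P: "Vector_Spaces.linear scale_op scale_op ?P"
    by (rule linear_orth_proj [OF subspace_commutant])
  have inv: "site_op k ?P X = X" for k
  proof (rule site_op_orth_proj_commutant)
    fix B assume "B \<in> S"
    then have "tensor (at_site k B) \<in> (local_ops S :: ('d, 'n) tensor_op set)"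
      unfolding local_ops_def using assms by (auto simp: at_site_def)
    with X show "X ** tensor (at_site k B) = tensor (at_site k B) ** X"
      by (simp add: commutant_def)
  qed
  have "X \<in> op.span {tensor U |U. \<forall>k\<in>T. U k \<in> commutant S}" if "finite T" for T
    using that
  proof (induction T)
    case empty
    have "unit_op a b \<in> op.span {tensor U |U. \<forall>k\<in>{}. U k \<in> commutant S}" for a b :: "'n \<Rightarrow> 'd"
      by (rule op.span_base) (auto simp flip: tensor_unit_op)
    then show ?case
      by (subst op_decomp) (intro op.span_sum op.span_scale)
  next
    case (insert k T)
    interpret Q: Vector_Spaces.linear scale_op scale_op "site_op k ?P :: ('d, 'n) tensor_op \<Rightarrow> _"
      by (rule linear_site_op [OF P])
    have "X \<in> site_op k ?P ` op.span {tensor U |U. \<forall>k\<in>T. U k \<in> commutant S}"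
      by (rule image_eqI [OF _ insert.IH]) (simp add: inv)
    also have "\<dots> = op.span (site_op k ?P ` {tensor U |U. \<forall>k\<in>T. U k \<in> commutant S})"
      by (rule Q.span_image [symmetric])
    also have "\<dots> \<subseteq> op.span {tensor U |U. \<forall>k\<in>insert k T. U k \<in> commutant S}"
    proof (rule op.span_mono, clarify)
      fix U :: "'n \<Rightarrow> 'd op" assume "\<forall>k\<in>T. U k \<in> commutant S"
      then show "\<exists>V. site_op k ?P (tensor U) = tensor V \<and> (\<forall>k\<in>insert k T. V k \<in> commutant S)"
        unfolding site_op_tensor [OF P]
        by (intro exI [of _ "U(k := ?P (U k))"]) (auto intro: orth_proj_in subspace_commutant)
    qed
    finally show ?case .
  qed
  from this [of UNIV] show "X \<in> op.span (local_ops (commutant S))"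
    by (simp add: local_ops_def)
qed

section \<open>Symmetric operators\<close>

text \<open>The sum of the conjugates of \<open>X\<close> by all \<open>perm_op s\<close>. It is
  left unnormalized, so on invariant operators it multiplies by the number of permutations.\<close>

definition symmetrize :: "('d::finite, 'n::finite) tensor_op \<Rightarrow> ('d, 'n) tensor_op" where
  "symmetrize X = (\<chi> i j. \<Sum>s | s permutes UNIV. X $ (i \<circ> s) $ (j \<circ> s))"

lemma linear_symmetrize: "Vector_Spaces.linear scale_op scale_op symmetrize"
  by unfold_locales (simp_all add: symmetrize_def vec_eq_iff sum.distrib sum_distrib_left)

lemma perm_op_commute_iff:
  fixes X :: "('d::finite, 'n::finite) tensor_op"
  assumes "s permutes UNIV"
  shows "X ** perm_op s = perm_op s ** X \<longleftrightarrow> (\<forall>i j. X $ (i \<circ> s) $ (j \<circ> s) = X $ i $ j)"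
proof -
  let ?t = "Hilbert_Choice.inv s"
  have s: "s \<circ> ?t = id" "?t \<circ> s = id"
    using assms by (simp_all add: permutes_inv_o)
  have eq: "i = j \<circ> ?t \<longleftrightarrow> j = i \<circ> s" for i j :: "'n \<Rightarrow> 'd"
    using s by (metis comp_assoc comp_id)
  have L: "(X ** perm_op s) $ i $ j = X $ i $ (j \<circ> ?t)" for i j
    by (simp add: matrix_matrix_mult_def perm_op_def if_distrib cong: if_cong)
  have R: "(perm_op s ** X) $ i $ j = X $ (i \<circ> s) $ j" for i j
    by (simp add: matrix_matrix_mult_def perm_op_def eq if_distrib [of "\<lambda>x. x * _"] cong: if_cong)
  have "X ** perm_op s = perm_op s ** X \<longleftrightarrow> (\<forall>i j. X $ i $ (j \<circ> ?t) = X $ (i \<circ> s) $ j)"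
    by (simp add: vec_eq_iff L R)
  also have "\<dots> \<longleftrightarrow> (\<forall>i j. X $ (i \<circ> s) $ (j \<circ> s) = X $ i $ j)"
  proof (intro iffI allI)
    fix i j :: "'n \<Rightarrow> 'd"
    assume "\<forall>i j. X $ i $ (j \<circ> ?t) = X $ (i \<circ> s) $ j"
    from this [rule_format, of i "j \<circ> s"] show "X $ (i \<circ> s) $ (j \<circ> s) = X $ i $ j"
      by (simp add: comp_assoc s)
  next
    fix i j :: "'n \<Rightarrow> 'd"
    assume "\<forall>i j. X $ (i \<circ> s) $ (j \<circ> s) = X $ i $ j"
    from this [rule_format, of i "j \<circ> ?t"] show "X $ i $ (j \<circ> ?t) = X $ (i \<circ> s) $ j"
      by (simp add: comp_assoc s)
  qed
  finally show ?thesis .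
qed

lemma symmetrize_commutant_perm_ops:
  fixes X :: "('d::finite, 'n::finite) tensor_op"
  assumes "X \<in> commutant perm_ops"
  shows "symmetrize X = scale_op (of_nat (fact CARD('n))) X"
proof -
  have "X $ (i \<circ> s) $ (j \<circ> s) = X $ i $ j" if "s permutes UNIV" for s i j
    using assms that perm_op_commute_iff [OF that, of X] by (auto simp: commutant_def perm_ops_def)
  then show ?thesis
    by (simp add: symmetrize_def vec_eq_iff card_permutations)
qed

section \<open>Permanents and polarization\<close>

lemma sum_alternating_supersets:
  fixes R :: "'n::finite set"
  shows "(\<Sum>S | R \<subseteq> S. (-1) ^ card (- S)) = (if R = UNIV then 1 else 0 :: complex)"
proof (cases "R = UNIV")
  case False
  \<comment> \<open>Complements of the supersets of \<open>R\<close> are the subsets of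
    \<open>- R\<close>; when \<open>- R\<close> is nonempty, equally many of these have even and odd
    size.\<close>
  have bij: "bij_betw uminus {S. R \<subseteq> S} (Pow (- R))"
    by (rule bij_betw_byWitness [where f' = uminus]) auto
  have "(\<Sum>S | R \<subseteq> S. (-1) ^ card (- S)) = (\<Sum>S\<in>Pow (- R). (-1) ^ card S :: complex)"
    using sum.reindex_bij_betw [OF bij, of "\<lambda>S. (-1) ^ card S :: complex"] by simp
  also have "\<dots> = 0"
    using False card_subsupersets_even_odd [of "- R" "{}"]
    by (intro sum_alternating_cancels) auto
  finally show ?thesis using False by simp
next
  case True
  then have "{S. R \<subseteq> S} = {UNIV}" by auto
  then show ?thesis using True by simp
qed

text \<open>Ryser's formula for the permanent. The product of sums expands over the maps
  \<open>g\<close> with range inside \<open>S\<close>; the signed sum over all \<open>S\<close>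
  containing the range keeps only surjective \<open>g\<close>, which on a finite type are the
  permutations.\<close>

lemma ryser_formula:
  fixes x :: "'n::finite \<Rightarrow> 'n \<Rightarrow> complex"
  shows "(\<Sum>s | s permutes UNIV. \<Prod>k\<in>UNIV. x k (s k)) =
    (\<Sum>S\<in>UNIV. (-1) ^ card (- S) * (\<Prod>k\<in>UNIV. \<Sum>l\<in>S. x k l))"
proof -
  have "(\<Prod>k\<in>UNIV. \<Sum>l\<in>S. x k l) = (\<Sum>g\<in>UNIV. if range g \<subseteq> S then \<Prod>k\<in>UNIV. x k (g k) else 0)" for S
  proof -
    have "(\<Prod>k\<in>UNIV. \<Sum>l\<in>S. x k l) = (\<Sum>g\<in>Pi\<^sub>E UNIV (\<lambda>_. S). \<Prod>k\<in>UNIV. x k (g k))"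
      by (rule prod_sum_PiE) auto
    also have "Pi\<^sub>E UNIV (\<lambda>_. S) = {g. range g \<subseteq> S}"
      by (auto simp: PiE_UNIV_domain)
    finally show ?thesis by (simp add: sum.If_cases)
  qed
  then have "(\<Sum>S\<in>UNIV. (-1) ^ card (- S) * (\<Prod>k\<in>UNIV. \<Sum>l\<in>S. x k l)) =
      (\<Sum>S\<in>UNIV. \<Sum>g\<in>UNIV. if range g \<subseteq> S then (-1) ^ card (- S) * (\<Prod>k\<in>UNIV. x k (g k)) else 0)"
    by (simp add: sum_distrib_left if_distrib cong: if_cong)
  also have "\<dots> = (\<Sum>g\<in>UNIV. \<Sum>S\<in>UNIV. if range g \<subseteq> S then (-1) ^ card (- S) * (\<Prod>k\<in>UNIV. x k (g k)) else 0)"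
    by (rule sum.swap)
  also have "\<dots> = (\<Sum>g\<in>UNIV. (\<Sum>S | range g \<subseteq> S. (-1) ^ card (- S)) * (\<Prod>k\<in>UNIV. x k (g k)))"
    by (simp add: sum.If_cases sum_distrib_right)
  also have "\<dots> = (\<Sum>g\<in>UNIV. if surj g then \<Prod>k\<in>UNIV. x k (g k) else 0)"
    by (simp add: sum_alternating_supersets if_distrib [of "\<lambda>x. x * _"] cong: if_cong)
  also have "\<dots> = (\<Sum>s | s permutes UNIV. \<Prod>k\<in>UNIV. x k (s k))"
  proof -
    have "surj g \<longleftrightarrow> g permutes UNIV" for g :: "'n \<Rightarrow> 'n"
      by (metis bij_def bij_imp_permutes finite_UNIV_surj_inj finite iso_tuple_UNIV_I permutes_surj)
    then show ?thesis by (simp add: sum.If_cases)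
  qed
  finally show ?thesis ..
qed

text \<open>Polarization: each entry on the left is the permanent of the array
  \<open>U l $ i k $ j k\<close>, and Ryser's formula rewrites it with the same partial sum of the
  \<open>U l\<close> at every site.\<close>

lemma symmetrize_tensor:
  fixes U :: "'n::finite \<Rightarrow> 'd::finite op"
  shows "symmetrize (tensor U) =
    (\<Sum>S\<in>UNIV. scale_op ((-1) ^ card (- S)) (tensor (\<lambda>_. \<Sum>l\<in>S. U l)))"
proof -
  have entry: "symmetrize (tensor U) $ i $ j =
      (\<Sum>S\<in>UNIV. (-1) ^ card (- S) * (\<Prod>k\<in>UNIV. \<Sum>l\<in>S. U l $ i k $ j k))" for i j
  proof -
    \<comment> \<open>Reindexing the product moves the permutation from the basis indices to the
      factors; the sum over all \<open>s\<close> then absorbs the inverse.\<close>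
    have "(\<Prod>k\<in>UNIV. U k $ i (s k) $ j (s k)) = (\<Prod>k\<in>UNIV. U (Hilbert_Choice.inv s k) $ i k $ j k)"
      if "s permutes UNIV" for s
      using prod.permute [OF that, of "\<lambda>k. U (Hilbert_Choice.inv s k) $ i k $ j k"] that
      by (simp add: o_def permutes_inverses)
    then have "symmetrize (tensor U) $ i $ j =
        (\<Sum>s | s permutes UNIV. \<Prod>k\<in>UNIV. U (Hilbert_Choice.inv s k) $ i k $ j k)"
      by (simp add: symmetrize_def tensor_def)
    also have "\<dots> = (\<Sum>s | s permutes UNIV. \<Prod>k\<in>UNIV. U (s k) $ i k $ j k)"
      by (rule sum_permutations_inverse [symmetric])
    finally show ?thesis
      using ryser_formula [of "\<lambda>k l. U l $ i k $ j k"] by simp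
  qed
  show ?thesis
    unfolding vec_eq_iff entry by (simp add: tensor_def)
qed

text \<open>Partial sums of elements of \<open>C\<close> stay in \<open>C\<close>, so polarization
  sends local operators to combinations of tensor powers; on \<open>X\<close> symmetrizing is
  multiplication by a nonzero factorial.\<close>

lemma symmetric_span_tensor_powers:
  fixes C :: "'d::finite op set" and X :: "('d, 'n::finite) tensor_op"
  assumes C: "op.subspace C" and X: "X \<in> op.span (local_ops C)" "X \<in> commutant perm_ops"
  shows "X \<in> op.span (tensor_powers C)"
proof -
  interpret s: Vector_Spaces.linear scale_op scale_op "symmetrize :: ('d, 'n) tensor_op \<Rightarrow> _"
    by (rule linear_symmetrize)
  have "symmetrize X \<in> symmetrize ` op.span (local_ops C)"
    using X by blast
  also have "\<dots> = op.span (symmetrize ` local_ops C)"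
    by (rule s.span_image [symmetric])
  also have "\<dots> \<subseteq> op.span (tensor_powers C)"
  proof (rule op.span_minimal, clarify)
    fix Y :: "('d, 'n) tensor_op" assume "Y \<in> local_ops C"
    then obtain U where U: "Y = tensor U" "\<And>k. U k \<in> C" by (auto simp: local_ops_def)
    have "(tensor (\<lambda>_. \<Sum>l\<in>S. U l) :: ('d, 'n) tensor_op) \<in> tensor_powers C" for S
      using U op.subspace_sum [OF C, of S U] by (auto simp: tensor_powers_def)
    then show "symmetrize Y \<in> op.span (tensor_powers C)"
      by (simp add: U symmetrize_tensor op.span_sum op.span_scale op.span_base)
  qed simp
  finally have "scale_op (inverse (of_nat (fact CARD('n)))) (symmetrize X) \<in> op.span (tensor_powers C)"
    by (rule op.span_scale)
  then show ?thesis
    using X by (simp add: symmetrize_commutant_perm_ops)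
qed

section \<open>Operators depending polynomially on a parameter\<close>

text \<open>A predicate on functions, so that determinants, sums and products are treated by closure
  rules without explicit coefficients.\<close>

definition polyfun :: "(complex \<Rightarrow> complex) \<Rightarrow> bool" where
  "polyfun f \<longleftrightarrow> (\<exists>p. f = poly p)"

lemma polyfun_const [intro, simp]: "polyfun (\<lambda>_. c)"
  unfolding polyfun_def by (rule exI [of _ "[:c:]"]) auto

lemma polyfun_ident [intro, simp]: "polyfun (\<lambda>z. z)"
  unfolding polyfun_def by (rule exI [of _ "[:0, 1:]"]) auto

lemma polyfun_add [intro]:
  assumes "polyfun f" "polyfun g"
  shows "polyfun (\<lambda>z. f z + g z)"
proof -
  obtain p q where "f = poly p" "g = poly q"
    using assms by (auto simp: polyfun_def)
  then show ?thesis
    by (auto simp: polyfun_def fun_eq_iff intro: exI [of _ "p + q"])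
qed

lemma polyfun_diff [intro]:
  assumes "polyfun f" "polyfun g"
  shows "polyfun (\<lambda>z. f z - g z)"
proof -
  obtain p q where "f = poly p" "g = poly q"
    using assms by (auto simp: polyfun_def)
  then show ?thesis
    by (auto simp: polyfun_def fun_eq_iff intro: exI [of _ "p - q"])
qed

lemma polyfun_mult [intro]:
  assumes "polyfun f" "polyfun g"
  shows "polyfun (\<lambda>z. f z * g z)"
proof -
  obtain p q where "f = poly p" "g = poly q"
    using assms by (auto simp: polyfun_def)
  then show ?thesis
    by (auto simp: polyfun_def fun_eq_iff intro: exI [of _ "p * q"])
qed

lemma polyfun_sum [intro]: "(\<And>i. i \<in> A \<Longrightarrow> polyfun (f i)) \<Longrightarrow> polyfun (\<lambda>z. \<Sum>i\<in>A. f i z)"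
  by (induction A rule: infinite_finite_induct) auto

lemma polyfun_prod [intro]: "(\<And>i. i \<in> A \<Longrightarrow> polyfun (f i)) \<Longrightarrow> polyfun (\<lambda>z. \<Prod>i\<in>A. f i z)"
  by (induction A rule: infinite_finite_induct) auto

lemma polyfun_finite_zeros:
  assumes "polyfun f" and "f a \<noteq> 0"
  shows "finite {z. f z = 0}"
proof -
  obtain p where p: "f = poly p" using assms by (auto simp: polyfun_def)
  with assms have "p \<noteq> 0" by auto
  then show ?thesis by (simp add: p poly_roots_finite)
qed

definition polymat :: "(complex \<Rightarrow> 'a::finite op) \<Rightarrow> bool" where
  "polymat M \<longleftrightarrow> (\<forall>i j. polyfun (\<lambda>z. M z $ i $ j))"

lemma polymat_const [simp]: "polymat (\<lambda>_. A)"
  by (simp add: polymat_def)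

lemma polymat_add: "polymat M \<Longrightarrow> polymat N \<Longrightarrow> polymat (\<lambda>z. M z + N z)"
  by (auto simp: polymat_def)

lemma polymat_diff: "polymat M \<Longrightarrow> polymat N \<Longrightarrow> polymat (\<lambda>z. M z - N z)"
  by (auto simp: polymat_def)

lemma polymat_mult: "polymat M \<Longrightarrow> polymat N \<Longrightarrow> polymat (\<lambda>z. M z ** N z)"
  by (auto intro!: polyfun_sum polyfun_mult simp: polymat_def matrix_matrix_mult_def)

lemma polymat_scale: "polyfun f \<Longrightarrow> polymat M \<Longrightarrow> polymat (\<lambda>z. scale_op (f z) (M z))"
  by (auto simp: polymat_def)

lemma polymat_tensor: "polymat M \<Longrightarrow> polymat (\<lambda>z. tensor (\<lambda>_. M z))"
  by (auto simp: polymat_def tensor_def)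

lemma polyfun_det: "polymat M \<Longrightarrow> polyfun (\<lambda>z. det (M z))"
  by (auto intro!: polyfun_sum polyfun_mult polyfun_prod simp: polymat_def det_def)

text \<open>The component of \<open>M z\<close> orthogonal to \<open>W\<close> is polynomial in
  \<open>z\<close> because the projection is linear; with infinitely many zeros it vanishes
  identically. Zariski density enters the proof in this form.\<close>

lemma polymat_subspace:
  assumes W: "op.subspace W" and M: "polymat M" and inf: "infinite {z. M z \<in> W}"
  shows "M z \<in> W"
proof (rule ccontr)
  assume z: "M z \<notin> W"
  let ?P = "orth_proj W"
  define D where "D = (\<lambda>z. M z - ?P (M z))"
  have "?P (M z) = (\<Sum>k\<in>UNIV. \<Sum>l\<in>UNIV. scale_op (M z $ k $ l) (?P (unit_op k l)))" for z
    by (rule linear_op_decomp [OF linear_orth_proj [OF W]])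
  then have "D z $ i $ j = M z $ i $ j -
      (\<Sum>k\<in>UNIV. \<Sum>l\<in>UNIV. M z $ k $ l * ?P (unit_op k l) $ i $ j)" for z i j
    unfolding D_def by simp
  then have "polymat D"
    using M unfolding polymat_def
    by (simp only:) (intro allI polyfun_diff polyfun_sum polyfun_mult polyfun_const; simp)
  have "D z \<noteq> 0"
    using z orth_proj_in [OF W, of "M z"] by (auto simp: D_def)
  then obtain i j where "D z $ i $ j \<noteq> 0"
    by (auto simp: vec_eq_iff)
  then have "finite {z. D z $ i $ j = 0}"
    using \<open>polymat D\<close> polyfun_finite_zeros [of "\<lambda>z. D z $ i $ j"] by (simp add: polymat_def)
  moreover have "{z. M z \<in> W} \<subseteq> {z. D z $ i $ j = 0}"
    by (auto simp: D_def orth_proj_ident [OF W])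
  ultimately show False
    using inf finite_subset by blast
qed

text \<open>The classical adjugate in the form given by Cramer's rule: column \<open>k\<close> of
  \<open>A\<close> is replaced by the basis vector of index \<open>l\<close>. Unlike the inverse, it
  is polynomial in the entries of \<open>A\<close>.\<close>

definition adjugate :: "'a::finite op \<Rightarrow> 'a op" where
  "adjugate A = (\<chi> k l. det (\<chi> i j. if j = k then mat 1 $ i $ l else A $ i $ j))"

lemma polymat_adjugate:
  assumes "polymat M"
  shows "polymat (\<lambda>z. adjugate (M z))"
proof -
  have "polyfun (\<lambda>z. if b then c else M z $ i $ j)" for b c i j
    using assms by (cases b) (simp_all add: polymat_def)
  then show ?thesis
    by (auto intro!: polyfun_det simp: polymat_def adjugate_def)
qed

lemma mult_adjugate:
  assumes "det A \<noteq> 0"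
  shows "A ** adjugate A = scale_op (det A) (mat 1)"
proof -
  have "A *v (\<chi> k. adjugate A $ k $ l / det A) = (\<chi> i. mat 1 $ i $ l)" for l
    by (subst cramer [OF assms]) (simp add: adjugate_def cong: if_cong)
  then have "(\<Sum>k\<in>UNIV. A $ i $ k * adjugate A $ k $ l) / det A = mat 1 $ i $ l" for i l
    by (simp add: matrix_vector_mult_def vec_eq_iff sum_divide_distrib)
  then show ?thesis
    using assms by (simp add: vec_eq_iff matrix_matrix_mult_def field_simps)
qed

section \<open>Density of the unitary elements\<close>

lemma centralizer_eq: "centralizer S = carrier unitary_group \<inter> commutant S"
  by (auto simp: centralizer_def commutant_def)

lemma carrier_unitary_group:
  "U \<in> carrier unitary_group \<longleftrightarrow> adjoint_op U ** U = mat 1 \<and> U ** adjoint_op U = mat 1"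
  by (simp add: unitary_group_def)

lemma mult_unitary_group [simp]: "mult unitary_group = (**)"
  and one_unitary_group [simp]: "one unitary_group = mat 1"
  by (simp_all add: unitary_group_def)

lemma inv_unitary_group:
  assumes "U \<in> carrier unitary_group"
  shows "m_inv unitary_group U = adjoint_op U"
  using assms
  by (intro group.inv_equality [OF group_unitary_group]) (auto simp: carrier_unitary_group)

lemma commute_inverse:
  fixes A B X :: "'a::finite op"
  assumes "X ** A = A ** X" and "A ** B = mat 1" and "B ** A = mat 1"
  shows "X ** B = B ** X"
proof -
  have "X ** B = B ** (A ** X) ** B"
    using assms by (simp add: matrix_mul_assoc)
  also have "\<dots> = B ** X ** (A ** B)"
    by (simp add: assms(1) [symmetric] matrix_mul_assoc)
  finally show ?thesis using assms by simp
qed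

text \<open>Commuting with unitaries passes to their products and inverses, so commutants can be
  computed on generators.\<close>

lemma commutant_generate:
  fixes S :: "'a::finite op set"
  assumes S: "S \<subseteq> carrier unitary_group"
  shows "commutant (generate unitary_group S) = commutant S"
proof
  show "commutant (generate unitary_group S) \<subseteq> commutant S"
    by (intro commutant_antimono) (auto intro: generate.incl)
  show "commutant S \<subseteq> commutant (generate unitary_group S)"
  proof
    fix X assume X: "X \<in> commutant S"
    have "X ** B = B ** X" if "B \<in> generate unitary_group S" for B
      using that
    proof induction
      case (inv h)
      then have "h \<in> carrier unitary_group" "X ** h = h ** X"
        using S X by (auto simp: commutant_def)
      then show ?case
        by (simp add: inv_unitary_group) (auto intro: commute_inverse simp: carrier_unitary_group)
    next
      case (eng h1 h2)
      then have "X ** (h1 ** h2) = h1 ** (h2 ** X)"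
        by (metis matrix_mul_assoc)
      then show ?case by (simp add: matrix_mul_assoc)
    qed (use X in \<open>auto simp: commutant_def\<close>)
    then show "X \<in> commutant (generate unitary_group S)"
      by (simp add: commutant_def)
  qed
qed

text \<open>Inverses of unitaries are adjoints, so the generated group is closed under adjoints and
  the bicommutant theorem applies.\<close>

lemma double_commutant_generate:
  assumes S: "S \<subseteq> carrier unitary_group"
  shows "commutant (commutant S) = complex_span (generate unitary_group S)"
proof -
  interpret group unitary_group by (rule group_unitary_group)
  have "commutant (commutant (generate unitary_group S)) = complex_span (generate unitary_group S)"
  proof (rule double_commutant)
    show "mat 1 \<in> generate unitary_group S"
      using generate.one [of unitary_group S] by simp
    show "A ** B \<in> generate unitary_group S"
      if "A \<in> generate unitary_group S" "B \<in> generate unitary_group S" for A B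
      using generate.eng [OF that] by simp
    show "adjoint_op A \<in> generate unitary_group S" if A: "A \<in> generate unitary_group S" for A
      using generate_m_inv_closed [OF S A] generate_in_carrier [OF S A]
      by (simp add: inv_unitary_group)
  qed
  then show ?thesis by (simp add: commutant_generate [OF S])
qed

section \<open>Adjoints, commutants and the Cayley transform\<close>

lemma adjoint_op_add: "adjoint_op (A + B) = adjoint_op A + adjoint_op B"
  and adjoint_op_diff: "adjoint_op (A - B) = adjoint_op A - adjoint_op B"
  and adjoint_op_scale: "adjoint_op (scale_op c A) = scale_op (cnj c) (adjoint_op A)"
  by (simp_all add: vec_eq_iff)

lemma adjoint_op_commutant:
  assumes "\<And>B. B \<in> S \<Longrightarrow> adjoint_op B \<in> S" and "X \<in> commutant S"
  shows "adjoint_op X \<in> commutant S"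
proof -
  have "adjoint_op X ** B = B ** adjoint_op X" if "B \<in> S" for B
  proof -
    have "adjoint_op (X ** adjoint_op B) = adjoint_op (adjoint_op B ** X)"
      using assms that by (simp add: commutant_def)
    then show ?thesis by (simp add: adjoint_op_mult)
  qed
  then show ?thesis by (simp add: commutant_def)
qed

lemma tensor_scale:
  "(tensor (\<lambda>_. scale_op c A) :: ('d::finite, 'n::finite) tensor_op) =
    scale_op (c ^ CARD('n)) (tensor (\<lambda>_. A))"
  by (simp add: tensor_def vec_eq_iff prod.distrib)

lemma mat_1_commutant: "mat 1 \<in> commutant S"
  by (simp add: commutant_def)

lemma mult_commutant:
  assumes "A \<in> commutant S" "B \<in> commutant S"
  shows "A ** B \<in> commutant S"
proof -
  have "A ** B ** C = C ** (A ** B)" if "C \<in> S" for C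
  proof -
    have "A ** B ** C = A ** (C ** B)"
      using assms that by (simp add: commutant_def matrix_mul_assoc [symmetric])
    also have "\<dots> = C ** A ** B"
      using assms that by (simp add: commutant_def matrix_mul_assoc)
    finally show ?thesis by (simp add: matrix_mul_assoc)
  qed
  then show ?thesis by (simp add: commutant_def)
qed

text \<open>Normality lets \<open>adjoint_op ?V ** ?V\<close> be regrouped as
  \<open>adjoint_op (N ** J) ** (N ** J)\<close>; in finite dimension a left inverse is
  two-sided.\<close>

lemma cayley_unitary:
  fixes N J :: "'a::finite op"
  assumes normal: "N ** adjoint_op N = adjoint_op N ** N" and inverse: "N ** J = mat 1"
  shows "adjoint_op N ** J \<in> carrier unitary_group"
proof -
  let ?V = "adjoint_op N ** J"
  have "adjoint_op (N ** J) = mat 1"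
    by (simp add: inverse)
  then have J: "adjoint_op J ** adjoint_op N = mat 1"
    by (simp add: adjoint_op_mult)
  have "adjoint_op ?V ** ?V = adjoint_op J ** (N ** adjoint_op N) ** J"
    by (simp add: adjoint_op_mult matrix_mul_assoc)
  also have "\<dots> = (adjoint_op J ** adjoint_op N) ** (N ** J)"
    by (simp add: normal matrix_mul_assoc)
  finally have "adjoint_op ?V ** ?V = mat 1"
    by (simp add: J inverse)
  then show ?thesis
    by (simp add: carrier_unitary_group matrix_left_right_inverse)
qed

text \<open>For hermitian \<open>P\<close> let \<open>N z = (1 + P) - z (P - 1)\<close>. At imaginary \<open>z\<close> the Cayley transform
  \<open>(N z)\<^sup>* (N z)\<^sup>-\<^sup>1\<close> is unitary, while the same rational expression at \<open>z = 1\<close> is \<open>P\<close>.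
  Clearing denominators with the adjugate makes it polynomial in \<open>z\<close>.\<close>

lemma hermitian_tensor_power:
  fixes S :: "'d::finite op set"
  assumes P: "P \<in> commutant S" "adjoint_op P = P"
  shows "(tensor (\<lambda>_. P) :: ('d, 'n::finite) tensor_op) \<in> op.span (tensor_powers (centralizer S))"
    (is "_ \<in> ?W")
proof -
  define N where "N = (\<lambda>z. (mat 1 + P) - scale_op z (P - mat 1))"
  \<comment> \<open>On the imaginary axis this is the adjoint of \<open>N z\<close>, written without
    conjugation so that it is polynomial in \<open>z\<close>.\<close>
  define N' where "N' = (\<lambda>z. (mat 1 + P) + scale_op z (P - mat 1))"
  define R where "R = (\<lambda>z. N' z ** adjugate (N z))"
  have poly: "polymat N" "polymat R"
    unfolding N_def N'_def R_def
    by (intro polymat_mult polymat_adjugate polymat_add polymat_diff polymat_scale polymat_const polyfun_ident)+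
  have N_comm: "N z \<in> commutant S" and N'_comm: "N' z \<in> commutant S" for z
    unfolding N_def N'_def using P
    by (auto intro!: op.subspace_diff op.subspace_add op.subspace_scale subspace_commutant mat_1_commutant)
  \<comment> \<open>For imaginary \<open>z\<close> this is the normality of
    \<open>N z\<close>.\<close>
  have commute: "N z ** N' z = N' z ** N z" for z
    by (simp add: N_def N'_def matrix_mult_distribs scale_op_mult_left scale_op_mult_right
        op.scale_right_diff_distrib op.scale_right_distrib)
  have N1: "N 1 = scale_op 2 (mat 1)" and N'1: "N' 1 = scale_op 2 P"
    by (simp_all add: N_def N'_def vec_eq_iff)
  have "N 1 ** scale_op (1/2) (mat 1) = mat 1"
    by (simp add: N1 scale_op_mult_left scale_op_mult_right)
  \<comment> \<open>Thus \<open>det (N z)\<close> is not the zero polynomial, and only finitely many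
    imaginary \<open>z\<close> have to be discarded below.\<close>
  then have det1: "det (N 1) \<noteq> 0"
    using invertible_det_nz invertible_right_inverse by blast
  have "infinite {z. (tensor (\<lambda>_. R z) :: ('d, 'n) tensor_op) \<in> ?W}"
  proof -
    have "tensor (\<lambda>_. R z) \<in> ?W" if z: "cnj z = - z" and d: "det (N z) \<noteq> 0" for z
    proof -
      let ?J = "scale_op (1 / det (N z)) (adjugate (N z))"
      have NJ: "N z ** ?J = mat 1"
        using d by (simp add: scale_op_mult_right mult_adjugate)
      then have JN: "?J ** N z = mat 1"
        by (simp add: matrix_left_right_inverse)
      have adj: "adjoint_op (N z) = N' z"
        using P z by (simp add: N_def N'_def adjoint_op_add adjoint_op_diff adjoint_op_scale)
      have "?J \<in> commutant S"
        unfolding commutant_def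
      proof clarify
        fix B assume "B \<in> S"
        then have "B ** N z = N z ** B"
          using N_comm [of z] by (simp add: commutant_def)
        then show "?J ** B = B ** ?J"
          by (rule commute_inverse [OF _ NJ JN, symmetric])
      qed
      then have "N' z ** ?J \<in> centralizer S"
        using cayley_unitary [OF _ NJ] commute [of z] N'_comm [of z]
        by (simp add: centralizer_eq mult_commutant adj)
      then have "tensor (\<lambda>_. N' z ** ?J) \<in> ?W"
        by (intro op.span_base) (auto simp: tensor_powers_def)
      moreover have "R z = scale_op (det (N z)) (N' z ** ?J)"
        using d by (simp add: R_def scale_op_mult_right)
      ultimately show ?thesis
        by (simp add: tensor_scale op.span_scale)
    qed
    then have "range (\<lambda>t. \<i> * complex_of_real t) - {z. det (N z) = 0} \<subseteq>
        {z. (tensor (\<lambda>_. R z) :: ('d, 'n) tensor_op) \<in> ?W}"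
      by auto
    moreover have "finite {z. det (N z) = 0}"
      by (rule polyfun_finite_zeros [where f = "\<lambda>z. det (N z)", OF polyfun_det [OF poly(1)] det1])
    then have "infinite (range (\<lambda>t. \<i> * complex_of_real t) - {z. det (N z) = 0})"
      by (intro Diff_infinite_finite) (simp_all add: finite_image_iff inj_on_def infinite_UNIV_char_0)
    ultimately show ?thesis
      using infinite_super by blast
  qed
  then have "tensor (\<lambda>_. R 1) \<in> ?W"
    by (intro polymat_subspace polymat_tensor poly) auto
  moreover have "R 1 = scale_op (det (N 1)) P"
  proof -
    \<comment> \<open>\<open>N 1\<close> is twice the identity, hence \<open>N' 1\<close> is
      \<open>P ** N 1\<close>.\<close>
    have "R 1 = P ** (N 1 ** adjugate (N 1))"
      by (simp add: R_def N1 N'1 scale_op_mult_left scale_op_mult_right)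
    then show ?thesis
      by (simp add: mult_adjugate det1 scale_op_mult_right)
  qed
  ultimately have "scale_op (1 / det (N 1) ^ CARD('n)) (tensor (\<lambda>_. R 1)) \<in> ?W"
    by (intro op.span_scale)
  with \<open>R 1 = _\<close> det1 show ?thesis
    by (simp add: tensor_scale)
qed

text \<open>Split \<open>A\<close> as \<open>H + scale_op \<i> K\<close> with \<open>H\<close> and
  \<open>K\<close> hermitian. For real \<open>t\<close> the operator \<open>H + scale_op t K\<close>
  is hermitian, and the tensor power is polynomial in \<open>t\<close>, so membership extends from
  the real line to \<open>\<i>\<close>.\<close>

lemma tensor_power_density:
  fixes S :: "'d::finite op set"
  assumes S: "\<And>B. B \<in> S \<Longrightarrow> adjoint_op B \<in> S" and A: "A \<in> commutant S"
  shows "(tensor (\<lambda>_. A) :: ('d, 'n::finite) tensor_op) \<in> op.span (tensor_powers (centralizer S))"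
    (is "_ \<in> ?W")
proof -
  define H where "H = scale_op (1/2) (A + adjoint_op A)"
  define K where "K = scale_op (- \<i> / 2) (A - adjoint_op A)"
  have H: "adjoint_op H = H" and K: "adjoint_op K = K"
    by (simp_all add: H_def K_def vec_eq_iff algebra_simps)
  have comm: "H \<in> commutant S" "K \<in> commutant S"
    unfolding H_def K_def using A adjoint_op_commutant [OF S A]
    by (auto intro!: op.subspace_neg op.subspace_diff op.subspace_add op.subspace_scale subspace_commutant)
  have decomp: "A = H + scale_op \<i> K"
    by (simp add: H_def K_def vec_eq_iff algebra_simps)
  have "tensor (\<lambda>_. H + scale_op (complex_of_real t) K) \<in> ?W" for t
    using comm H K
    by (intro hermitian_tensor_power)
      (auto simp: adjoint_op_add adjoint_op_scale intro!: op.subspace_add op.subspace_scale subspace_commutant)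
  then have "range complex_of_real \<subseteq>
      {z. (tensor (\<lambda>_. H + scale_op z K) :: ('d, 'n) tensor_op) \<in> ?W}"
    by auto
  moreover have "infinite (range complex_of_real)"
    by (simp add: finite_image_iff inj_on_def infinite_UNIV_char_0)
  ultimately have "infinite {z. (tensor (\<lambda>_. H + scale_op z K) :: ('d, 'n) tensor_op) \<in> ?W}"
    using infinite_super by blast
  then show ?thesis
    unfolding decomp
    by (intro polymat_subspace [where M = "\<lambda>z. tensor (\<lambda>_. H + scale_op z K)"]
        polymat_tensor polymat_add polymat_scale polymat_const polyfun_ident) auto
qed

text \<open>One inclusion chains localization, polarization and density. For the other, a tensor
  power commutes with local operators factor by factor, and permuting equal factors changes
  nothing.\<close>

lemma commutant_local_perm_ops:
  fixes S :: "'d::finite op set"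
  assumes one: "mat 1 \<in> S" and adj: "\<And>B. B \<in> S \<Longrightarrow> adjoint_op B \<in> S"
  shows "commutant (local_ops S \<union> perm_ops :: ('d, 'n::finite) tensor_op set) =
    op.span (tensor_powers (centralizer S))"
proof
  show "commutant (local_ops S \<union> perm_ops :: ('d, 'n) tensor_op set) \<subseteq> op.span (tensor_powers (centralizer S))"
  proof
    fix X :: "('d, 'n) tensor_op"
    assume "X \<in> commutant (local_ops S \<union> perm_ops)"
    then have X: "X \<in> commutant (local_ops S)" "X \<in> commutant perm_ops"
      by (auto simp: commutant_def)
    then have "X \<in> op.span (tensor_powers (commutant S))"
      using commutant_local_ops_subset [OF one]
      by (blast intro: symmetric_span_tensor_powers subspace_commutant)
    also have "\<dots> \<subseteq> op.span (tensor_powers (centralizer S))"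
      using tensor_power_density [OF adj]
      by (intro op.span_minimal) (auto simp: tensor_powers_def)
    finally show "X \<in> op.span (tensor_powers (centralizer S))" .
  qed
  show "op.span (tensor_powers (centralizer S)) \<subseteq> commutant (local_ops S \<union> perm_ops :: ('d, 'n) tensor_op set)"
  proof (rule op.span_minimal [OF _ subspace_commutant], clarify)
    fix X :: "('d, 'n) tensor_op" assume "X \<in> tensor_powers (centralizer S)"
    then obtain V where X: "X = tensor (\<lambda>_. V)" and V: "V \<in> commutant S"
      by (auto simp: tensor_powers_def centralizer_eq)
    have "X ** tensor U = tensor U ** X" if "\<And>k. U k \<in> S" for U
      using V that by (simp add: X tensor_mult commutant_def)
    moreover have "X ** perm_op s = perm_op s ** X" if "s permutes UNIV" for s
      unfolding perm_op_commute_iff [OF that]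
    proof (intro allI)
      fix i j
      show "X $ (i \<circ> s) $ (j \<circ> s) = X $ i $ j"
        using prod.permute [OF that, of "\<lambda>k. V $ i k $ j k"] by (simp add: X tensor_def o_def)
    qed
    ultimately show "X \<in> commutant (local_ops S \<union> perm_ops)"
      by (auto simp: commutant_def local_ops_def perm_ops_def)
  qed
qed

theorem theorem3:
  fixes G G' :: "'d::finite op set"
  assumes "subgroup G unitary_group"
    and "subgroup G' unitary_group"
    and "centralizer G = G'"
    and "centralizer G' = G"
  shows "commutant (complex_span (tensor_powers G :: ('d, 'n::finite) tensor_op set)) =
           complex_span (generate unitary_group (local_ops G' \<union> perm_ops)) \<and>
         commutant (complex_span (generate unitary_group (local_ops G' \<union> perm_ops))) =
           complex_span (tensor_powers G :: ('d, 'n) tensor_op set)"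
proof -
  let ?S = "local_ops G' \<union> perm_ops :: ('d, 'n) tensor_op set"
  interpret G': subgroup G' unitary_group by fact
  have one: "mat 1 \<in> G'"
    using G'.one_closed by simp
  have adj: "adjoint_op B \<in> G'" if "B \<in> G'" for B
    using G'.m_inv_closed [OF that] G'.mem_carrier [OF that] by (simp add: inv_unitary_group)
  have S: "?S \<subseteq> carrier unitary_group"
    using G'.mem_carrier by (auto simp: local_ops_def perm_ops_def intro: tensor_unitary perm_op_unitary)
  \<comment> \<open>This one commutant yields both claims: passing from generators to spans gives
    the second, and a further commutant, by the bicommutant theorem, gives the first.\<close>
  have "commutant ?S = complex_span (tensor_powers G)"
    using commutant_local_perm_ops [OF one adj] assms(4) by (simp add: complex_span_eq)
  then show ?thesis
    using double_commutant_generate [OF S]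
    by (simp add: commutant_complex_span commutant_generate [OF S])
qed

end
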